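(* Let $S\subset\mathbb{Q}^n$ be a finitely generated subsemigroup of the additive group of the $n$-dimensional vector space $\mathbb{Q}^n$ over the rational numbers, and let $\succ$ be a total order on $S$ compatible with addition. Then $S$ is a well-ordered set with respect to $\succ$ if and only if $2a\succ a$ for every nonzero element $a\in S$.
   Context: A total order is understood as a strict total order. A total order $\succ$ on a commutative semigroup $S$ is compatible with addition if for all $x,y,a\in S$ with $x\succ y$ one has $x+a\succ y+a$. A subsemigroup is a subset closed under addition (it need not contain $0$); it is finitely generated if it consists of all finite nonempty sums of elements of some finite subset. $S$ is well-ordered with respect to $\succ$ if every nonempty subset of $S$ has a smallest element, where $x$ is smaller than $y$ when $y\succ x$. *)

theory Defs
  imports "HOL-Analysis.Finite_Cartesian_Product"
begin

definition subsemigroup :: "'a::ab_semigroup_add set \<Rightarrow> bool" where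
  "subsemigroup S \<longleftrightarrow> (\<forall>x\<in>S. \<forall>y\<in>S. x + y \<in> S)"

definition nonempty_sums :: "'a::comm_monoid_add set \<Rightarrow> 'a set" where
  "nonempty_sums G = {sum_list xs | xs. xs \<noteq> [] \<and> set xs \<subseteq> G}"

definition finitely_generated :: "'a::comm_monoid_add set \<Rightarrow> bool" where
  "finitely_generated S \<longleftrightarrow> (\<exists>G. finite G \<and> G \<subseteq> S \<and> S = nonempty_sums G)"

(* Orders are relations on the ambient type, of which only the restriction to S matters;
   gr x y reads "x is greater than y". *)

definition strict_total_order_on :: "'a set \<Rightarrow> ('a \<Rightarrow> 'a \<Rightarrow> bool) \<Rightarrow> bool" where
  "strict_total_order_on S gr \<longleftrightarrow> irreflp_on S gr \<and> transp_on S gr \<and> totalp_on S gr"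

definition add_compatible_on ::
    "'a::ab_semigroup_add set \<Rightarrow> ('a \<Rightarrow> 'a \<Rightarrow> bool) \<Rightarrow> bool" where
  "add_compatible_on S gr \<longleftrightarrow> (\<forall>x\<in>S. \<forall>y\<in>S. \<forall>a\<in>S. gr x y \<longrightarrow> gr (x + a) (y + a))"

definition well_ordered_on :: "'a set \<Rightarrow> ('a \<Rightarrow> 'a \<Rightarrow> bool) \<Rightarrow> bool" where
  "well_ordered_on S gr \<longleftrightarrow>
     (\<forall>T. T \<subseteq> S \<and> T \<noteq> {} \<longrightarrow> (\<exists>m\<in>T. \<forall>x\<in>T. x \<noteq> m \<longrightarrow> gr x m))"

end

(* If 2a > a for all nonzero a, then cancellation gives x + a > x for all x. Writing the elements
   of S as sums of multisets of generators, a strictly decreasing sequence in S would contradict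
   Dickson's lemma, which yields i < j such that the j-th multiset contains the i-th one. *)
theory Submission
  imports Defs "HOL-Library.Multiset"
begin

text \<open>Any sequence has a monotone subsequence, and a decreasing sequence of naturals is
  eventually constant, so dropping finitely many terms makes it increasing too.\<close>

lemma mono_subseq_nat:
  fixes f :: "nat \<Rightarrow> nat"
  shows "\<exists>r :: nat \<Rightarrow> nat. strict_mono r \<and> mono (f \<circ> r)"
proof -
  obtain r :: "nat \<Rightarrow> nat" where r: "strict_mono r" "monoseq (\<lambda>n. f (r n))"
    using seq_monosub[of f] by blast
  show ?thesis
  proof (cases "incseq (\<lambda>n. f (r n))")
    case True
    with r(1) show ?thesis by (intro exI[of _ r]) (simp add: comp_def)
  next
    case False
    then have dec: "decseq (\<lambda>n. f (r n))"
      using r(2) by (simp add: monoseq_iff)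
    \<comment> \<open>\<open>N\<close> is an index where the subsequence takes its least value;
      being decreasing, it keeps that value from \<open>N\<close> on.\<close>
    obtain N where N: "\<And>n. f (r N) \<le> f (r n)"
      using ex_has_least_nat[of "\<lambda>_. True" _ "\<lambda>n. f (r n)"] by auto
    have "f (r (n + N)) = f (r N)" for n
      using N[of "n + N"] decseqD[OF dec, of N "n + N"] by simp
    then have "mono (f \<circ> (\<lambda>n. r (n + N)))"
      by (simp add: monoI)
    moreover have "strict_mono (\<lambda>n. r (n + N))"
      using r(1) by (simp add: strict_mono_def)
    ultimately show ?thesis by blast
  qed
qed

text \<open>Refine once per element of \<open>G\<close>: passing to a further subsequence keeps the
  counts already treated monotone.\<close>

lemma mono_subseq_multisets:
  fixes M :: "nat \<Rightarrow> 'a multiset"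
  assumes "finite G"
  shows "\<exists>r :: nat \<Rightarrow> nat. strict_mono r \<and> (\<forall>g\<in>G. mono (\<lambda>n. count (M (r n)) g))"
  using assms
proof (induction G rule: finite_induct)
  case empty
  show ?case by (intro exI[of _ id]) (simp add: strict_mono_def)
next
  case (insert g G)
  then obtain r :: "nat \<Rightarrow> nat"
    where r: "strict_mono r" "\<And>h. h \<in> G \<Longrightarrow> mono (\<lambda>n. count (M (r n)) h)"
    by blast
  obtain s :: "nat \<Rightarrow> nat" where s: "strict_mono s" "mono ((\<lambda>n. count (M (r n)) g) \<circ> s)"
    using mono_subseq_nat by blast
  have "mono (\<lambda>n. count (M (r (s n))) h)" if "h \<in> insert g G" for h
  proof (cases "h = g")
    case True
    then show ?thesis using s(2) by (simp add: comp_def)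
  next
    case False
    then have "mono (\<lambda>n. count (M (r n)) h)" using that r(2) by simp
    then show ?thesis
      using strict_mono_mono[OF s(1)] by (simp add: mono_def)
  qed
  moreover have "strict_mono (\<lambda>n. r (s n))"
    using r(1) s(1) by (simp add: strict_mono_def)
  ultimately show ?case by blast
qed

text \<open>Along the common subsequence every count of an element of \<open>G\<close> increases,
  and all other counts are zero, so its first two terms are already comparable.\<close>

lemma Dickson_multiset:
  fixes M :: "nat \<Rightarrow> 'a multiset"
  assumes "finite G" "\<And>n. set_mset (M n) \<subseteq> G"
  shows "\<exists>i j. i < j \<and> M i \<subseteq># M j"
proof -
  obtain r :: "nat \<Rightarrow> nat"
    where r: "strict_mono r" "\<And>g. g \<in> G \<Longrightarrow> mono (\<lambda>n. count (M (r n)) g)"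
    using mono_subseq_multisets[OF assms(1)] by blast
  have "count (M (r 0)) g \<le> count (M (r 1)) g" for g
  proof (cases "g \<in> G")
    case True
    then show ?thesis using r(2) by (simp add: mono_def)
  next
    case False
    then have "g \<notin># M (r 0)" using assms(2) by blast
    then show ?thesis by (simp add: not_in_iff)
  qed
  then have "M (r 0) \<subseteq># M (r 1)" by (simp add: subseteq_mset_def)
  moreover have "r 0 < r 1" using r(1) by (simp add: strict_mono_def)
  ultimately show ?thesis by blast
qed

text \<open>By commutativity the order of the summands is irrelevant. Multisets make inclusion and
  difference of representations available; nonemptiness is kept because \<open>0\<close> need not be
  such a sum.\<close>

lemma in_nonempty_sums_iff:
  "x \<in> nonempty_sums G \<longleftrightarrow> (\<exists>M. M \<noteq> {#} \<and> set_mset M \<subseteq> G \<and> x = sum_mset M)"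
proof
  assume "x \<in> nonempty_sums G"
  then obtain xs where "xs \<noteq> []" "set xs \<subseteq> G" "x = sum_list xs"
    unfolding nonempty_sums_def by blast
  then show "\<exists>M. M \<noteq> {#} \<and> set_mset M \<subseteq> G \<and> x = sum_mset M"
    by (intro exI[of _ "mset xs"]) (simp add: sum_mset_sum_list)
next
  assume "\<exists>M. M \<noteq> {#} \<and> set_mset M \<subseteq> G \<and> x = sum_mset M"
  then obtain M where M: "M \<noteq> {#}" "set_mset M \<subseteq> G" "x = sum_mset M" by blast
  obtain xs where "mset xs = M" using ex_mset by blast
  with M have "xs \<noteq> [] \<and> set xs \<subseteq> G \<and> x = sum_list xs"
    by (auto simp: sum_mset_sum_list)
  then show "x \<in> nonempty_sums G" unfolding nonempty_sums_def by blast
qed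

text \<open>Otherwise totality gives a > 2a, and translating by a repeatedly yields the descending
  chain a > 2a > 3a > ..., which a well-order forbids.\<close>

lemma well_ordered_imp_double_greater:
  fixes S :: "'a::cancel_comm_monoid_add set"
  assumes "subsemigroup S" "strict_total_order_on S gr" "add_compatible_on S gr"
    and wo: "well_ordered_on S gr" and a: "a \<in> S" "a \<noteq> 0"
  shows "gr (a + a) a"
proof (rule ccontr)
  assume "\<not> gr (a + a) a"
  moreover have irr: "irreflp_on S gr" and tr: "transp_on S gr" and tot: "totalp_on S gr"
    using assms(2) by (auto simp: strict_total_order_on_def)
  have cl: "x + y \<in> S" if "x \<in> S" "y \<in> S" for x y
    using assms(1) that by (simp add: subsemigroup_def)
  moreover have "a + a \<noteq> a" using a(2) by simp
  ultimately have "gr a (a + a)"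
    using totalp_onD[OF tot, of a "a + a"] a(1) by auto
  \<comment> \<open>\<open>T\<close> collects the elements that adding \<open>a\<close> makes
    smaller. It contains \<open>a\<close> and is closed under adding \<open>a\<close>, so no element
    of it can be least; this replaces an explicit sequence of multiples of \<open>a\<close>.\<close>
  define T where "T = {x \<in> S. gr x (x + a)}"
  have "a \<in> T" using \<open>gr a (a + a)\<close> a(1) by (simp add: T_def)
  have "T \<subseteq> S" by (auto simp: T_def)
  moreover have "T \<noteq> {}" using \<open>a \<in> T\<close> by auto
  ultimately have "\<exists>m\<in>T. \<forall>x\<in>T. x \<noteq> m \<longrightarrow> gr x m"
    using wo unfolding well_ordered_on_def by simp
  then obtain m where m: "m \<in> T" "\<And>x. x \<in> T \<Longrightarrow> x \<noteq> m \<Longrightarrow> gr x m" by auto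
  then have mS: "m \<in> S" "m + a \<in> S" "gr m (m + a)" using cl a(1) by (auto simp: T_def)
  then have "gr (m + a) (m + a + a)"
    using assms(3) a(1) by (simp add: add_compatible_on_def)
  then have "m + a \<in> T" using mS by (simp add: T_def)
  moreover have "m + a \<noteq> m" using a(2) by simp
  ultimately have "gr (m + a) m" using m(2) by blast
  then have "gr m m" using transp_onD[OF tr] mS by blast
  then show False using irreflp_onD[OF irr] mS by blast
qed

text \<open>By cancellation x + a differs from x, so failure means x > x + a. Adding a gives x + a >
  x + 2a, whereas adding x to 2a > a gives x + 2a > x + a.\<close>

lemma add_greater_of_double_greater:
  fixes S :: "'a::cancel_comm_monoid_add set"
  assumes "subsemigroup S" "strict_total_order_on S gr" "add_compatible_on S gr"
    and "gr (a + a) a" and S: "a \<in> S" "x \<in> S" and a: "a \<noteq> 0"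
  shows "gr (x + a) x"
proof (rule ccontr)
  assume "\<not> gr (x + a) x"
  have irr: "irreflp_on S gr" and tr: "transp_on S gr" and tot: "totalp_on S gr"
    using assms(2) by (auto simp: strict_total_order_on_def)
  have cl: "x + a \<in> S" "a + a \<in> S" "x + a + a \<in> S"
    using assms(1) S by (auto simp: subsemigroup_def)
  have "gr x (x + a)"
    using totalp_onD[OF tot, of x "x + a"] \<open>\<not> gr (x + a) x\<close> S cl a by auto
  then have "gr (x + a) (x + a + a)"
    using assms(3) S cl by (simp add: add_compatible_on_def)
  moreover have "gr (a + a + x) (a + x)"
    using assms(3,4) S cl by (simp add: add_compatible_on_def)
  then have "gr (x + a + a) (x + a)" by (simp add: ac_simps)
  ultimately have "gr (x + a) (x + a)" using transp_onD[OF tr] cl by blast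
  then show False using irreflp_onD[OF irr] cl by blast
qed

text \<open>In a set without least element, totality provides a smaller element below each one, and
  dependent choice strings these into a sequence. Descent is recorded for all i < j, not just for
  neighbours, since Dickson's lemma controls only some pair of indices.\<close>

lemma well_ordered_on_if_no_descending_seq:
  assumes "strict_total_order_on S gr"
    and no_desc: "\<And>t :: nat \<Rightarrow> _. (\<And>n. t n \<in> S) \<Longrightarrow> (\<And>i j. i < j \<Longrightarrow> gr (t i) (t j)) \<Longrightarrow> False"
  shows "well_ordered_on S gr"
proof (rule ccontr)
  assume "\<not> well_ordered_on S gr"
  then obtain T where T: "T \<subseteq> S" "T \<noteq> {}" "\<And>m. m \<in> T \<Longrightarrow> \<exists>x\<in>T. x \<noteq> m \<and> \<not> gr x m"
    unfolding well_ordered_on_def by auto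
  have tr: "transp_on S gr" and tot: "totalp_on S gr"
    using assms(1) by (auto simp: strict_total_order_on_def)
  have "\<exists>x\<in>T. gr m x" if "m \<in> T" for m
    using T(1) T(3)[OF that] that totalp_onD[OF tot] by (meson subsetD)
  then obtain t where t: "\<And>n. t n \<in> T" "\<And>n. gr (t n) (t (Suc n))"
    using dependent_nat_choice[of "\<lambda>_ x. x \<in> T" "\<lambda>_ x y. gr x y"] T(2) by (metis ex_in_conv)
  have tS: "t n \<in> S" for n using t(1) T(1) by blast
  have "gr (t i) (t j)" if "i < j" for i j
    using that
  proof (induction rule: strict_inc_induct)
    case (base i)
    then show ?case using t(2) by simp
  next
    case (step i)
    then show ?case using transp_onD[OF tr tS tS tS] t(2) by blast
  qed
  then show False using no_desc tS by blast
qed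

lemma double_greater_imp_well_ordered:
  fixes S :: "'a::cancel_comm_monoid_add set"
  assumes "subsemigroup S" "finitely_generated S"
    and "strict_total_order_on S gr" "add_compatible_on S gr"
    and dbl: "\<And>a. a \<in> S \<Longrightarrow> a \<noteq> 0 \<Longrightarrow> gr (a + a) a"
  shows "well_ordered_on S gr"
proof (rule well_ordered_on_if_no_descending_seq[OF assms(3)])
  fix t :: "nat \<Rightarrow> 'a"
  assume tS: "\<And>n. t n \<in> S" and desc: "\<And>i j. i < j \<Longrightarrow> gr (t i) (t j)"
  have irr: "irreflp_on S gr" and tr: "transp_on S gr"
    using assms(3) by (auto simp: strict_total_order_on_def)
  obtain G where G: "finite G" "S = nonempty_sums G"
    using assms(2) unfolding finitely_generated_def by blast
  have "\<forall>n. \<exists>M. set_mset M \<subseteq> G \<and> t n = sum_mset M"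
    using tS unfolding G(2) in_nonempty_sums_iff by blast
  then obtain M where M: "\<And>n. set_mset (M n) \<subseteq> G" "\<And>n. t n = sum_mset (M n)"
    by metis
  obtain i j where ij: "i < j" "M i \<subseteq># M j"
    using Dickson_multiset[OF G(1) M(1)] by blast
  \<comment> \<open>\<open>D\<close> is the surplus of generators in the later term, so
    \<open>t j\<close> arises from \<open>t i\<close> by adding its sum.\<close>
  define D where "D = M j - M i"
  have tj: "t j = t i + sum_mset D"
    using ij(2) by (simp add: M(2) D_def flip: sum_mset.union)
  have "t j = t i \<or> gr (t j) (t i)"
  \<comment> \<open>The split is on the sum, not on \<open>D\<close>: copies of a generator
    \<open>0\<close> give a nonempty \<open>D\<close> with zero sum, and \<open>dbl\<close> speaks
    of nonzero elements only. A nonzero sum forces \<open>D\<close> to be nonempty, which puts the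
    sum in \<open>S\<close>.\<close>
  proof (cases "sum_mset D = 0")
    case True
    then show ?thesis using tj by simp
  next
    case False
    then have "D \<noteq> {#}" by auto
    moreover have "set_mset D \<subseteq> G" using M(1)[of j] by (auto simp: D_def dest: in_diffD)
    ultimately have "sum_mset D \<in> S" unfolding G(2) in_nonempty_sums_iff by blast
    then show ?thesis
      using add_greater_of_double_greater[OF assms(1,3,4) dbl] tS False tj by simp
  qed
  moreover have "gr (t i) (t j)" using desc ij(1) .
  \<comment> \<open>Both alternatives clash with the descent from \<open>t i\<close> to
    \<open>t j\<close>: equality directly, the reverse comparison by transitivity.\<close>
  ultimately have "gr (t i) (t i)" using transp_onD[OF tr tS tS tS] by metis
  then show False using irreflp_onD[OF irr tS] by blast
qed

theorem theorem30:
  fixes S :: "(rat ^ 'n) set"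
    and gr :: "rat ^ 'n \<Rightarrow> rat ^ 'n \<Rightarrow> bool"  (infix "\<succ>" 50)
  assumes "subsemigroup S"
    and "finitely_generated S"
    and "strict_total_order_on S (\<succ>)"
    and "add_compatible_on S (\<succ>)"
  shows "well_ordered_on S (\<succ>) \<longleftrightarrow> (\<forall>a\<in>S. a \<noteq> 0 \<longrightarrow> a + a \<succ> a)"
  using well_ordered_imp_double_greater[OF assms(1,3,4)]
    double_greater_imp_well_ordered[OF assms] by blast

end
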